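(* Let $w,v\in\mathbb{N}$, let $(\ell_1,\dots,\ell_w)$ be positive integers, let $\sigma\in\mathcal S_w$, and let $\lambda,\mu\in S(\ell_{\sigma(1)},\dots,\ell_{\sigma(w)})$. 1. If $\lambda<_\sigma\mu$, then $W^\sigma_\lambda|_\mu=0$. 2. If $\lambda\ge_\sigma\mu$, then $\deg(W^\sigma_\lambda|_\lambda)\ge\deg(W^\sigma_\lambda|_\mu)$.
   Context: For positive integers $(l_1,\dots,l_w)$, $S(l_1,\dots,l_w)=\{(v_1,\dots,v_w)\in\mathbb{N}^w\mid0\le v_i\le l_i,\ \sum_iv_i=v\}$. A permutation $\sigma$ acts on tuples by $\sigma(v_1,\dots,v_w)=(v_{\sigma(1)},\dots,v_{\sigma(w)})$; thus $\sigma^{-1}\lambda=(\lambda_{\sigma^{-1}(1)},\dots,\lambda_{\sigma^{-1}(w)})\in S(\ell_1,\dots,\ell_w)$ for $\lambda\in S(\ell_{\sigma(1)},\dots,\ell_{\sigma(w)})$. On $S(\ell_1,\dots,\ell_w)$ use the lexicographic order ($\nu<\nu'$ iff at the first index where they differ $\nu$ has the smaller entry); on $S(\ell_{\sigma(1)},\dots,\ell_{\sigma(w)})$ define $\lambda\le_\sigma\mu\iff\sigma^{-1}(\lambda)\le\sigma^{-1}(\mu)$. **Weight functions.** For $\nu=(v_1,\dots,v_w)\in S(\ell_1,\dots,\ell_w)$, $W^{\mathrm{id}}_\nu=\sum_IW^{\mathrm{id}}_{\nu,I}$, the sum over ordered set partitions $I=(I_1,\dots,I_w)$ of $\{1,\dots,v\}$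 with $|I_j|=v_j$, where $$W^{\mathrm{id}}_{\nu,I}=\prod_{1\le t<s\le w}\prod_{i\in I_s,k\in I_t}\frac{y_i-y_k-2\hbar}{y_k-y_i}\cdot\prod_{1\le s<a\le w}\prod_{i\in I_s}(z_a-y_i+\ell_a\hbar)\cdot\prod_{1\le a<s\le w}\prod_{i\in I_s}(y_i-z_a+\ell_a\hbar).$$ $W^{\mathrm{id}}_\nu$ is a polynomial in $\hbar,y,z$, symmetric in $y_1,\dots,y_v$. For $\lambda\in S(\ell_{\sigma(1)},\dots,\ell_{\sigma(w)})$, $$W^\sigma_\lambda(y_1,\dots,y_v;z_1,\dots,z_w;\hbar):=W^{\mathrm{id}}_{\sigma^{-1}\lambda}(y_1,\dots,y_v;z_{\sigma^{-1}(1)},\dots,z_{\sigma^{-1}(w)};\hbar),$$ and similarly $W^\sigma_{\lambda,I}$ is obtained from the summand $W^{\mathrm{id}}_{\sigma^{-1}\lambda,I}$. **Restriction.** For $\mu\in S(\ell_{\sigma(1)},\dots,\ell_{\sigma(w)})$, $|_\mu$ denotes the substitution of $y_1,\dots,y_v$ by the elements $z_k-(\ell_{\sigma(k)}-2j)\hbar$, $0\le j\le\mu_k-1$, $1\le k\le w$ (in any fixed order; the restriction of the full $W^\sigma_\lambda$ does not depend on the order). Each nonzero $W^\sigma_{\lambda,I}|_\mu$ is a product of factors and inverses of factors of the form $\pm(z_a-z_b)+c\hbar$ ($a\ne b$) and constants in $\mathbb{C}\hbar^{\mathbb Z}$. **Degree.** $\deg(W^\sigma_{\lambda,I}|_\mu)$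 is the degree in $z_1,\dots,z_w$ (with $\deg z_i=1$, $\deg\hbar=0$; numerator degree minus denominator degree), and $\deg(W^\sigma_\lambda|_\mu)=\max_I\deg(W^\sigma_{\lambda,I}|_\mu)$, with the convention $\deg0=-\infty$. *)

theory Defs
  imports
    "HOL-Library.Poly_Mapping"
    "HOL-Library.FuncSet"
    "HOL-Library.Fun_Lexorder"
    "HOL-Library.Extended"
    "HOL-Combinatorics.Permutations"
    "HOL-Computational_Algebra.Computational_Algebra"
begin

section \<open>Tuples and their orders\<close>

text \<open>A tuple $(v_1,\dots,v_w)$ is an extensional function on \<open>{1..w}\<close>, so that equality of tuples
  is equality of functions.\<close>

definition S_set :: "nat \<Rightarrow> nat \<Rightarrow> (nat \<Rightarrow> nat) \<Rightarrow> (nat \<Rightarrow> nat) set" where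
  "S_set w v l = {\<nu> \<in> (\<Pi>\<^sub>E i\<in>{1..w}. {0..l i}). (\<Sum>i\<in>{1..w}. \<nu> i) = v}"

definition perm_tuple :: "(nat \<Rightarrow> nat) \<Rightarrow> (nat \<Rightarrow> nat) \<Rightarrow> nat \<Rightarrow> nat" where
  "perm_tuple \<sigma> \<nu> = (\<lambda>i. \<nu> (\<sigma> i))"

text \<open>Extensional functions agree outside \<open>{1..w}\<close>, so \<^const>\<open>less_fun\<close> compares exactly the
  entries with indices in \<open>{1..w}\<close>.\<close>

definition less_perm :: "(nat \<Rightarrow> nat) \<Rightarrow> (nat \<Rightarrow> nat) \<Rightarrow> (nat \<Rightarrow> nat) \<Rightarrow> bool" where
  "less_perm \<sigma> lam \<mu> \<longleftrightarrow> less_fun (perm_tuple (inv \<sigma>) lam) (perm_tuple (inv \<sigma>) \<mu>)"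

definition le_perm :: "(nat \<Rightarrow> nat) \<Rightarrow> (nat \<Rightarrow> nat) \<Rightarrow> (nat \<Rightarrow> nat) \<Rightarrow> bool" where
  "le_perm \<sigma> lam \<mu> \<longleftrightarrow>
     perm_tuple (inv \<sigma>) lam = perm_tuple (inv \<sigma>) \<mu> \<or> less_perm \<sigma> lam \<mu>"


section \<open>Weight functions\<close>

definition ordered_partitions :: "nat \<Rightarrow> nat \<Rightarrow> (nat \<Rightarrow> nat) \<Rightarrow> (nat \<Rightarrow> nat set) set" where
  "ordered_partitions w v \<nu> =
     {I \<in> {1..w} \<rightarrow>\<^sub>E Pow {1..v}.
        disjoint_family_on I {1..w} \<and> (\<Union>j\<in>{1..w}. I j) = {1..v} \<and> (\<forall>j\<in>{1..w}. card (I j) = \<nu> j)}"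

text \<open>The rational expressions in $y$, $z$, $\hbar$ are functions of arguments from an arbitrary
  field. They have the intended value whenever the \<open>y i\<close> are pairwise different; lemma
  \<open>inj_restr_point\<close> below shows that this is so for the substitutions of interest. The summand
  depends on $\nu$ only through the partition.\<close>

definition W_id_summand ::
  "nat \<Rightarrow> (nat \<Rightarrow> nat) \<Rightarrow> (nat \<Rightarrow> nat set) \<Rightarrow> (nat \<Rightarrow> 'a::field) \<Rightarrow> (nat \<Rightarrow> 'a) \<Rightarrow> 'a \<Rightarrow> 'a" where
  "W_id_summand w l I y z h =
     (\<Prod>s\<in>{1..w}. \<Prod>t\<in>{1..<s}. \<Prod>i\<in>I s. \<Prod>k\<in>I t. (y i - y k - 2 * h) / (y k - y i)) *
     (\<Prod>s\<in>{1..w}. \<Prod>a\<in>{s<..w}. \<Prod>i\<in>I s. z a - y i + of_nat (l a) * h) *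
     (\<Prod>s\<in>{1..w}. \<Prod>a\<in>{1..<s}. \<Prod>i\<in>I s. y i - z a + of_nat (l a) * h)"

definition W_id ::
  "nat \<Rightarrow> nat \<Rightarrow> (nat \<Rightarrow> nat) \<Rightarrow> (nat \<Rightarrow> nat) \<Rightarrow> (nat \<Rightarrow> 'a::field) \<Rightarrow> (nat \<Rightarrow> 'a) \<Rightarrow> 'a \<Rightarrow> 'a" where
  "W_id w v l \<nu> y z h = (\<Sum>I\<in>ordered_partitions w v \<nu>. W_id_summand w l I y z h)"

definition W_perm_summand ::
  "nat \<Rightarrow> (nat \<Rightarrow> nat) \<Rightarrow> (nat \<Rightarrow> nat) \<Rightarrow> (nat \<Rightarrow> nat set) \<Rightarrow>
   (nat \<Rightarrow> 'a::field) \<Rightarrow> (nat \<Rightarrow> 'a) \<Rightarrow> 'a \<Rightarrow> 'a" where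
  "W_perm_summand w l \<sigma> I y z h = W_id_summand w l I y (\<lambda>i. z (inv \<sigma> i)) h"

definition W_perm ::
  "nat \<Rightarrow> nat \<Rightarrow> (nat \<Rightarrow> nat) \<Rightarrow> (nat \<Rightarrow> nat) \<Rightarrow> (nat \<Rightarrow> nat) \<Rightarrow>
   (nat \<Rightarrow> 'a::field) \<Rightarrow> (nat \<Rightarrow> 'a) \<Rightarrow> 'a \<Rightarrow> 'a" where
  "W_perm w v l \<sigma> lam y z h = W_id w v l (perm_tuple (inv \<sigma>) lam) y (\<lambda>i. z (inv \<sigma> i)) h"


section \<open>Rational functions in the variables z over the polynomials in hbar\<close>

text \<open>\<open>zpoly\<close> is the polynomial ring $\mathbb{C}[\hbar][z_0,z_1,\dots]$: the outer exponents belong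
  to the $z_i$, the coefficients are polynomials in $\hbar$.\<close>

type_synonym zpoly = "(nat \<Rightarrow>\<^sub>0 nat) \<Rightarrow>\<^sub>0 complex poly"
type_synonym zrat = "zpoly fract"

definition zvar :: "nat \<Rightarrow> zrat" where
  "zvar i = Fract (Poly_Mapping.single (Poly_Mapping.single i 1) 1) 1"

definition hbar :: zrat where
  "hbar = Fract (Poly_Mapping.single 0 [:0, 1:]) 1"

definition mon_degree :: "(nat \<Rightarrow>\<^sub>0 nat) \<Rightarrow> nat" where
  "mon_degree m = (\<Sum>i\<in>Poly_Mapping.keys m. Poly_Mapping.lookup m i)"

definition z_degree :: "zpoly \<Rightarrow> nat" where
  "z_degree p = Max (mon_degree ` Poly_Mapping.keys p)"

text \<open>Numerator degree minus denominator degree; independent of the representing fraction by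
  \<open>rat_degree_Fract\<close> below.\<close>

definition rat_degree :: "zrat \<Rightarrow> int extended" where
  "rat_degree f =
     (if f = 0 then Minf
      else (THE d. \<exists>p q. p \<noteq> 0 \<and> q \<noteq> 0 \<and> f = Fract p q \<and>
                         d = Fin (int (z_degree p) - int (z_degree q))))"

lemma mon_degree_add: "mon_degree (m + n) = mon_degree m + mon_degree n"
proof -
  let ?K = "Poly_Mapping.keys m \<union> Poly_Mapping.keys n"
  have *: "mon_degree x = (\<Sum>i\<in>?K. Poly_Mapping.lookup x i)" if "Poly_Mapping.keys x \<subseteq> ?K" for x
    unfolding mon_degree_def using that
    by (intro sum.mono_neutral_left) (auto simp: in_keys_iff)
  have "mon_degree (m + n) = (\<Sum>i\<in>?K. Poly_Mapping.lookup (m + n) i)"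
    by (rule *) (rule keys_add)
  then show ?thesis
    by (simp add: *[of m] *[of n] lookup_add sum.distrib)
qed

text \<open>Grading by the $z$-degree, as a ring homomorphism.\<close>

definition grade :: "zpoly \<Rightarrow> zpoly poly" where
  "grade p = (\<Sum>m\<in>Poly_Mapping.keys p.
     monom (Poly_Mapping.single m (Poly_Mapping.lookup p m)) (mon_degree m))"

lemma lookup_coeff_grade:
  "Poly_Mapping.lookup (coeff (grade p) n) m =
     (if mon_degree m = n then Poly_Mapping.lookup p m else 0)"
proof -
  have "Poly_Mapping.lookup (coeff (grade p) n) m =
     (\<Sum>k\<in>Poly_Mapping.keys p. if k = m then (if mon_degree m = n then Poly_Mapping.lookup p m else 0) else 0)"
    unfolding grade_def coeff_sum lookup_sum
    by (intro sum.cong) (auto simp: lookup_single when_def)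
  also have "\<dots> = (if mon_degree m = n then Poly_Mapping.lookup p m else 0)"
    by (simp add: in_keys_iff)
  finally show ?thesis .
qed

lemma grade_add: "grade (p + q) = grade p + grade q"
  by (intro poly_eqI poly_mapping_eqI) (simp add: lookup_coeff_grade lookup_add)

lemma grade_single: "grade (Poly_Mapping.single m a) = monom (Poly_Mapping.single m a) (mon_degree m)"
  by (intro poly_eqI poly_mapping_eqI) (auto simp add: lookup_coeff_grade lookup_single when_def)

lemma zpoly_induct [case_names single add]:
  assumes "\<And>m a. P (Poly_Mapping.single m a)" "\<And>p q. P p \<Longrightarrow> P q \<Longrightarrow> P (p + q)"
  shows "P (p :: zpoly)"
proof (induction p rule: update_induct)
  case const
  show ?case using assms(1)[of 0 0] by simp
next
  case (update f a b)
  have "Poly_Mapping.update a b f = f + Poly_Mapping.single a b"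
    using update(1)
    by (intro poly_mapping_eqI) (auto simp: lookup_add lookup_single lookup_update in_keys_iff when_def)
  then show ?case using assms update by simp
qed

lemma grade_mult: "grade (p * q) = grade p * grade q"
proof (induction p rule: zpoly_induct)
  case (single m a)
  show ?case
    by (induction q rule: zpoly_induct)
       (simp_all add: mult_single grade_single mult_monom mon_degree_add distrib_left grade_add)
next
  case (add p q)
  then show ?case by (simp add: distrib_right grade_add)
qed

lemma degree_grade:
  assumes "p \<noteq> 0"
  shows "degree (grade p) = z_degree p"
proof (rule antisym)
  have fin: "finite (mon_degree ` Poly_Mapping.keys p)" by simp
  show "degree (grade p) \<le> z_degree p"
  proof (rule degree_le, intro allI impI poly_mapping_eqI)
    fix i m assume "z_degree p < i"
    have "mon_degree m \<noteq> i" if "Poly_Mapping.lookup p m \<noteq> 0"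
    proof -
      have "mon_degree m \<le> z_degree p"
        unfolding z_degree_def using that fin by (intro Max_ge) (auto simp: in_keys_iff)
      then show ?thesis using \<open>z_degree p < i\<close> by simp
    qed
    then show "Poly_Mapping.lookup (coeff (grade p) i) m = Poly_Mapping.lookup 0 m"
      by (auto simp: lookup_coeff_grade)
  qed
  have "z_degree p \<in> mon_degree ` Poly_Mapping.keys p"
    unfolding z_degree_def using assms fin by (intro Max_in) auto
  then obtain m where m: "m \<in> Poly_Mapping.keys p" "mon_degree m = z_degree p" by force
  then have "Poly_Mapping.lookup (coeff (grade p) (z_degree p)) m \<noteq> 0"
    by (simp add: lookup_coeff_grade in_keys_iff)
  then have "coeff (grade p) (z_degree p) \<noteq> 0" by auto
  then show "z_degree p \<le> degree (grade p)" by (rule le_degree)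
qed

lemma z_degree_mult:
  assumes "p \<noteq> 0" "q \<noteq> 0"
  shows "z_degree (p * q) = z_degree p + z_degree q"
proof -
  have nz: "grade p \<noteq> 0" if "p \<noteq> 0" for p
  proof
    assume "grade p = 0"
    then have "Poly_Mapping.lookup p m = 0" for m
      using lookup_coeff_grade[of p "mon_degree m" m] by simp
    then have "p = 0" by (intro poly_mapping_eqI) simp
    with that show False by contradiction
  qed
  have "p * q \<noteq> 0" using assms by simp
  then have "z_degree (p * q) = degree (grade p * grade q)"
    by (simp add: degree_grade[symmetric] grade_mult)
  also have "\<dots> = degree (grade p) + degree (grade q)"
    using nz assms by (intro degree_mult_eq) auto
  finally show ?thesis using assms by (simp add: degree_grade)
qed

lemma rat_degree_Fract:
  assumes "p \<noteq> 0" "q \<noteq> 0"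
  shows "rat_degree (Fract p q) = Fin (int (z_degree p) - int (z_degree q))"
proof -
  have "Fract p q \<noteq> 0" using assms by (simp add: Zero_fract_def eq_fract)
  moreover have "(THE d. \<exists>p' q'. p' \<noteq> 0 \<and> q' \<noteq> 0 \<and> Fract p q = Fract p' q' \<and>
                         d = Fin (int (z_degree p') - int (z_degree q'))) =
        Fin (int (z_degree p) - int (z_degree q))"
  proof (rule the_equality)
    show "\<exists>p' q'. p' \<noteq> 0 \<and> q' \<noteq> 0 \<and> Fract p q = Fract p' q' \<and>
        Fin (int (z_degree p) - int (z_degree q)) = Fin (int (z_degree p') - int (z_degree q'))"
      using assms by blast
  next
    fix d assume "\<exists>p' q'. p' \<noteq> 0 \<and> q' \<noteq> 0 \<and> Fract p q = Fract p' q' \<and>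
                         d = Fin (int (z_degree p') - int (z_degree q'))"
    then obtain p' q' where *: "p' \<noteq> 0" "q' \<noteq> 0" "Fract p q = Fract p' q'"
      and d: "d = Fin (int (z_degree p') - int (z_degree q'))" by blast
    have "p * q' = p' * q" using * assms by (simp add: eq_fract)
    then have "z_degree p + z_degree q' = z_degree p' + z_degree q"
      using z_degree_mult[of p q'] z_degree_mult[of p' q] * assms by simp
    then show "d = Fin (int (z_degree p) - int (z_degree q))"
      unfolding d by simp
  qed
  ultimately show ?thesis by (simp add: rat_degree_def)
qed


section \<open>Restriction\<close>

definition restr_index :: "nat \<Rightarrow> (nat \<Rightarrow> nat) \<Rightarrow> (nat \<times> nat) set" where
  "restr_index w \<mu> = {(k, j). k \<in> {1..w} \<and> j < \<mu> k}"

definition restr_point :: "(nat \<Rightarrow> nat) \<Rightarrow> (nat \<Rightarrow> nat) \<Rightarrow> nat \<times> nat \<Rightarrow> zrat" where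
  "restr_point l \<sigma> = (\<lambda>(k, j). zvar k - of_int (int (l (\<sigma> k)) - 2 * int j) * hbar)"

text \<open>An enumeration \<open>e\<close> stands for the substitution of \<open>restr_point l \<sigma> (e i)\<close> for $y_i$.\<close>

definition restr_orders :: "nat \<Rightarrow> nat \<Rightarrow> (nat \<Rightarrow> nat) \<Rightarrow> (nat \<Rightarrow> nat \<times> nat) set" where
  "restr_orders w v \<mu> = {e. bij_betw e {1..v} (restr_index w \<mu>)}"

definition W_restr ::
  "nat \<Rightarrow> nat \<Rightarrow> (nat \<Rightarrow> nat) \<Rightarrow> (nat \<Rightarrow> nat) \<Rightarrow> (nat \<Rightarrow> nat) \<Rightarrow> (nat \<Rightarrow> nat \<times> nat) \<Rightarrow> zrat" where
  "W_restr w v l \<sigma> lam e = W_perm w v l \<sigma> lam (\<lambda>i. restr_point l \<sigma> (e i)) zvar hbar"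

definition W_summand_restr ::
  "nat \<Rightarrow> (nat \<Rightarrow> nat) \<Rightarrow> (nat \<Rightarrow> nat) \<Rightarrow> (nat \<Rightarrow> nat set) \<Rightarrow> (nat \<Rightarrow> nat \<times> nat) \<Rightarrow> zrat" where
  "W_summand_restr w l \<sigma> I e = W_perm_summand w l \<sigma> I (\<lambda>i. restr_point l \<sigma> (e i)) zvar hbar"

text \<open>The degree of a restricted weight function is by convention the maximum of the degrees of
  its summands, not the degree of the sum \<^const>\<open>W_restr\<close>.\<close>

definition W_restr_degree ::
  "nat \<Rightarrow> nat \<Rightarrow> (nat \<Rightarrow> nat) \<Rightarrow> (nat \<Rightarrow> nat) \<Rightarrow> (nat \<Rightarrow> nat) \<Rightarrow> (nat \<Rightarrow> nat \<times> nat) \<Rightarrow>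
   int extended" where
  "W_restr_degree w v l \<sigma> lam e =
     Max ((\<lambda>I. rat_degree (W_summand_restr w l \<sigma> I e)) `
          ordered_partitions w v (perm_tuple (inv \<sigma>) lam))"

lemma of_int_fract: "(of_int c :: 'a::idom fract) = Fract (of_int c) 1"
proof -
  have n: "(of_nat n :: 'a fract) = Fract (of_nat n) 1" for n
    by (induction n) (simp_all add: Zero_fract_def One_fract_def)
  show ?thesis
    by (cases c rule: int_cases2) (simp_all add: n)
qed

lemma inj_restr_point: "inj (restr_point l \<sigma>)"
proof (rule injI)
  fix x x' :: "nat \<times> nat"
  obtain k j k' j' where x: "x = (k, j)" "x' = (k', j')" by (metis surj_pair)
  define c c' where "c = int (l (\<sigma> k)) - 2 * int j" and "c' = int (l (\<sigma> k')) - 2 * int j'"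
  define P :: "nat \<Rightarrow> int \<Rightarrow> zpoly" where
    "P = (\<lambda>k c. Poly_Mapping.single (Poly_Mapping.single k 1) 1 -
                Poly_Mapping.single 0 (of_int c * [:0, 1:]))"
  have pt: "zvar k - of_int c * hbar = Fract (P k c) 1" for k c
    by (simp add: zvar_def hbar_def of_int_fract P_def mult_single flip: single_of_int)
  assume "restr_point l \<sigma> x = restr_point l \<sigma> x'"
  then have "zvar k - of_int c * hbar = zvar k' - of_int c' * hbar"
    unfolding x restr_point_def c_def c'_def by (simp only: prod.case)
  then have eq: "P k c = P k' c'"
    unfolding pt by (simp add: eq_fract)
  have "Poly_Mapping.lookup (P k c) (Poly_Mapping.single k 1) =
        Poly_Mapping.lookup (P k' c') (Poly_Mapping.single k 1)" by (simp add: eq)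
  moreover have ne: "Poly_Mapping.single i (1::nat) \<noteq> 0" for i :: nat
    by (metis lookup_single_eq lookup_zero one_neq_zero)
  moreover have sk: "i = i'" if "Poly_Mapping.single i (1::nat) = Poly_Mapping.single i' 1"
    for i i' :: nat
    using that by (metis lookup_single_eq lookup_single_not_eq one_neq_zero)
  ultimately have k: "k = k'"
    by (auto simp: P_def lookup_minus lookup_single when_def dest: sk split: if_splits)
  have "Poly_Mapping.lookup (P k c) 0 = Poly_Mapping.lookup (P k' c') 0" by (simp add: eq)
  then have "of_int c * [:0, 1 :: complex:] = of_int c' * [:0, 1:]"
    using ne by (simp add: P_def lookup_minus lookup_single when_def)
  then have "c = c'" by (metis mult_right_cancel of_int_eq_iff pCons_eq_0_iff one_neq_zero)
  then show "x = x'" using k by (simp add: x c_def c'_def)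
qed

end

theory Submission
  imports Defs
begin

text \<open>
  Index the columns by $p = 1,\dots,w$: column $p$ consists of the points
  $z_{\sigma^{-1}(p)} - (\ell_p - 2j)\hbar$ with $0 \le j < \mu_{\sigma^{-1}(p)}$. A partition $I$
  distributes the points substituted for the $y_i$ over classes, the point for $y_i$ lying in
  class $s$ if $i \in I_s$. Both claims are read off from the individual summands.

  At height $j$ in column $a$ the factor $y_i - z_{\sigma^{-1}(a)} + \ell_a\hbar$ is $2j\hbar$, and
  it occurs for all points in classes beyond $a$. So a summand is killed if the bottom point of a
  column $a$ lies in a class beyond $a$. It is also killed, by a factor $y_i - y_k - 2\hbar$, if
  the class increases when going up one step in a column. In a nonzero summand the class of a
  point is therefore at most its column (\<open>class_le_column\<close>). Counting the points in the columns
  up to $a$, the partial sums of $\sigma^{-1}\mu$ are at most those of $\sigma^{-1}\lambda$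
  (\<open>partial_sums_le\<close>), which rules out that $\sigma^{-1}\lambda$ is lexicographically smaller. So
  for $\lambda <_\sigma \mu$ every summand vanishes on its own, without any cancellation.

  For the degrees, each quotient has degree at most $0$ and each of the $v(w-1)$ linear factors
  degree at most $1$, which bounds all degrees by $v(w-1)$ (\<open>degree_summand_le\<close>). On the
  restriction to $\lambda$ itself, the partition whose classes are the columns attains this bound
  (\<open>degree_column_partition\<close>): its factors only ever compare different columns, so that the
  $z$-variables never cancel.
\<close>

section \<open>Degrees of rational functions\<close>

lemma rat_degree_0: "rat_degree 0 = Minf"
  by (simp add: rat_degree_def)

lemma rat_degree_nonzero:
  assumes "f \<noteq> 0"
  obtains d where "rat_degree f = Fin d"
proof -
  obtain p q where f: "f = Fract p q" "q \<noteq> 0" by (cases f) auto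
  then have "p \<noteq> 0" using assms by (auto simp: Zero_fract_def eq_fract)
  then show ?thesis using f that by (simp add: rat_degree_Fract)
qed

lemma rat_degree_eq_Fin_imp_nonzero: "rat_degree f = Fin d \<Longrightarrow> f \<noteq> 0"
  by (auto simp: rat_degree_0)

lemma rat_degree_mult_eq:
  assumes "rat_degree f = Fin a" "rat_degree g = Fin b"
  shows "rat_degree (f * g) = Fin (a + b)"
proof -
  have nz: "f \<noteq> 0" "g \<noteq> 0" using assms by (auto dest: rat_degree_eq_Fin_imp_nonzero)
  obtain p q where f: "f = Fract p q" "q \<noteq> 0" by (cases f) auto
  obtain r s where g: "g = Fract r s" "s \<noteq> 0" by (cases g) auto
  have "p \<noteq> 0" "r \<noteq> 0" using nz f g by (auto simp: Zero_fract_def eq_fract)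
  then show ?thesis
    using assms f g by (auto simp: rat_degree_Fract z_degree_mult)
qed

lemma rat_degree_mult_le:
  assumes "rat_degree f \<le> Fin a" "rat_degree g \<le> Fin b"
  shows "rat_degree (f * g) \<le> Fin (a + b)"
proof (cases "f = 0 \<or> g = 0")
  case True
  then show ?thesis by (auto simp: rat_degree_0)
next
  case False
  then obtain c d where "rat_degree f = Fin c" "rat_degree g = Fin d"
    by (meson rat_degree_nonzero)
  then show ?thesis using assms by (simp add: rat_degree_mult_eq)
qed

lemma rat_degree_1: "rat_degree 1 = Fin 0"
  unfolding One_fract_def by (subst rat_degree_Fract) auto

lemma rat_degree_prod_eq:
  assumes "\<And>x. x \<in> A \<Longrightarrow> rat_degree (f x) = Fin (d x)"
  shows "rat_degree (\<Prod>x\<in>A. f x) = Fin (\<Sum>x\<in>A. d x)"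
  using assms
  by (induction A rule: infinite_finite_induct) (simp_all add: rat_degree_1 rat_degree_mult_eq)

lemma rat_degree_prod_le:
  assumes "\<And>x. x \<in> A \<Longrightarrow> rat_degree (f x) \<le> Fin (d x)"
  shows "rat_degree (\<Prod>x\<in>A. f x) \<le> Fin (\<Sum>x\<in>A. d x)"
  using assms
  by (induction A rule: infinite_finite_induct) (simp_all add: rat_degree_1 rat_degree_mult_le)

lemma rat_degree_divide_eq:
  assumes "rat_degree f = Fin a" "rat_degree g = Fin b"
  shows "rat_degree (f / g) = Fin (a - b)"
proof -
  have "g \<noteq> 0" using assms(2) by (rule rat_degree_eq_Fin_imp_nonzero)
  have "f / g \<noteq> 0" using assms by (auto dest: rat_degree_eq_Fin_imp_nonzero)
  then obtain c where c: "rat_degree (f / g) = Fin c" by (rule rat_degree_nonzero)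
  have "Fin a = rat_degree (f / g * g)" using \<open>g \<noteq> 0\<close> assms(1) by simp
  also have "\<dots> = Fin (c + b)" by (rule rat_degree_mult_eq[OF c assms(2)])
  finally show ?thesis by (simp add: c)
qed


section \<open>The linear factors after restriction\<close>

text \<open>All numerators, denominators and linear factors of a restricted summand have this
  shape. It loses its $z$-degree, or even
  vanishes, exactly if both variables are the same.\<close>

definition lin_form :: "nat \<Rightarrow> nat \<Rightarrow> int \<Rightarrow> zrat" where
  "lin_form p q c = zvar p - zvar q + of_int c * hbar"

lemma mon_degree_single: "mon_degree (Poly_Mapping.single i n) = n"
  by (simp add: mon_degree_def)

lemma of_int_mult_hbar: "of_int c * hbar = Fract (Poly_Mapping.single 0 (of_int c * [:0, 1:])) 1"
  by (simp add: hbar_def of_int_fract mult_single flip: single_of_int)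

lemma rat_degree_lin_form_ne:
  assumes "p \<noteq> q"
  shows "rat_degree (lin_form p q c) = Fin 1"
proof -
  define x where "x = (\<lambda>i::nat. Poly_Mapping.single i (1::nat))"
  define P :: zpoly where
    "P = Poly_Mapping.single (x p) 1 - Poly_Mapping.single (x q) 1
       + Poly_Mapping.single 0 (of_int c * [:0, 1:])"
  have lin: "lin_form p q c = Fract P 1"
    by (simp add: lin_form_def of_int_mult_hbar zvar_def P_def x_def)
  have deg_x: "mon_degree (x i) = 1" for i
    by (simp add: x_def mon_degree_single)
  have "x p \<noteq> x q" "x p \<noteq> 0"
    using assms by (auto simp: x_def dest!: arg_cong[of _ _ "\<lambda>m. Poly_Mapping.lookup m p"]
        simp: lookup_single)
  then have key: "x p \<in> Poly_Mapping.keys P"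
    by (simp add: P_def in_keys_iff lookup_add lookup_minus lookup_single when_def)
  have "mon_degree m \<le> 1" if "m \<in> Poly_Mapping.keys P" for m
  proof -
    have "m = x p \<or> m = x q \<or> m = 0"
      using that by (auto simp: P_def in_keys_iff lookup_add lookup_minus lookup_single when_def
          split: if_splits)
    then show ?thesis by (auto simp: deg_x) (simp add: mon_degree_def)
  qed
  then have "z_degree P = 1"
    unfolding z_degree_def using key deg_x by (intro Max_eqI) (auto intro: rev_image_eqI)
  moreover have "P \<noteq> 0" using key by auto
  moreover have "z_degree 1 = 0"
    by (simp add: z_degree_def mon_degree_def)
  ultimately show ?thesis by (simp add: lin rat_degree_Fract)
qed

lemma rat_degree_lin_form_same:
  assumes "c \<noteq> 0"
  shows "rat_degree (lin_form p p c) = Fin 0"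
proof -
  let ?P = "Poly_Mapping.single 0 (of_int c * [:0, 1:]) :: zpoly"
  have "of_int c * [:0, 1 :: complex:] \<noteq> 0" using assms by simp
  then have keys: "Poly_Mapping.keys ?P = {0}" by (simp only: keys_single if_False)
  then have "?P \<noteq> 0" by (metis keys_zero insert_not_empty)
  moreover have "z_degree ?P = 0"
    unfolding z_degree_def keys by (simp add: mon_degree_def)
  moreover have "z_degree 1 = 0" by (simp add: z_degree_def mon_degree_def)
  ultimately show ?thesis by (simp add: lin_form_def of_int_mult_hbar rat_degree_Fract)
qed

lemma lin_form_same_0: "lin_form p p 0 = 0"
  by (simp add: lin_form_def)

lemma rat_degree_lin_form_le: "rat_degree (lin_form p q c) \<le> Fin 1"
  by (cases "p = q"; cases "c = 0")
     (simp_all add: rat_degree_lin_form_ne rat_degree_lin_form_same lin_form_same_0 rat_degree_0)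

abbreviation level :: "(nat \<Rightarrow> nat) \<Rightarrow> (nat \<Rightarrow> nat) \<Rightarrow> nat \<times> nat \<Rightarrow> int" where
  "level l \<sigma> x \<equiv> int (l (\<sigma> (fst x))) - 2 * int (snd x)"

lemma restr_point_eq: "restr_point l \<sigma> x = zvar (fst x) - of_int (level l \<sigma> x) * hbar"
  by (cases x) (simp add: restr_point_def)

lemma restr_point_numerator:
  "restr_point l \<sigma> x - restr_point l \<sigma> y - 2 * hbar =
     lin_form (fst x) (fst y) (level l \<sigma> y - level l \<sigma> x - 2)"
  by (simp add: restr_point_eq lin_form_def algebra_simps)

lemma restr_point_denominator:
  "restr_point l \<sigma> y - restr_point l \<sigma> x =
     lin_form (fst y) (fst x) (level l \<sigma> x - level l \<sigma> y)"
  by (simp add: restr_point_eq lin_form_def algebra_simps)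

lemma restr_point_upper_factor:
  "zvar a - restr_point l \<sigma> x + of_nat n * hbar = lin_form a (fst x) (level l \<sigma> x + int n)"
  by (simp add: restr_point_eq lin_form_def algebra_simps)

lemma restr_point_lower_factor:
  "restr_point l \<sigma> x - zvar a + of_nat n * hbar = lin_form (fst x) a (int n - level l \<sigma> x)"
  by (simp add: restr_point_eq lin_form_def algebra_simps)

abbreviation y_quotient :: "(nat \<Rightarrow> nat) \<Rightarrow> (nat \<Rightarrow> nat) \<Rightarrow> nat \<times> nat \<Rightarrow> nat \<times> nat \<Rightarrow> zrat" where
  "y_quotient l \<sigma> x y \<equiv>
     (restr_point l \<sigma> x - restr_point l \<sigma> y - 2 * hbar) / (restr_point l \<sigma> y - restr_point l \<sigma> x)"

lemma rat_degree_y_quotient_ne: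
  assumes "fst x \<noteq> fst y"
  shows "rat_degree (y_quotient l \<sigma> x y) = Fin 0"
  using rat_degree_divide_eq[OF rat_degree_lin_form_ne rat_degree_lin_form_ne] assms
  unfolding restr_point_numerator unfolding restr_point_denominator by simp

text \<open>Within one column the numerator and the denominator both are multiples of $\hbar$, hence of
  degree $0$ unless they vanish.\<close>

lemma rat_degree_y_quotient_le: "rat_degree (y_quotient l \<sigma> x y) \<le> Fin 0"
proof (cases "fst x = fst y")
  case False
  then show ?thesis by (simp add: rat_degree_y_quotient_ne)
next
  case same: True
  show ?thesis
  proof (cases "y_quotient l \<sigma> x y = 0")
    case False
    obtain c d where cd: "y_quotient l \<sigma> x y = lin_form (fst x) (fst x) c / lin_form (fst x) (fst x) d"
      unfolding restr_point_numerator unfolding restr_point_denominator using same by metis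
    with False have "c \<noteq> 0" "d \<noteq> 0" by (auto simp: lin_form_same_0)
    then show ?thesis
      using rat_degree_divide_eq[OF rat_degree_lin_form_same rat_degree_lin_form_same]
      unfolding cd by simp
  qed (simp only: rat_degree_0 Minf_le)
qed


section \<open>Vanishing\<close>

lemma ordered_partition_class_subset:
  assumes "I \<in> ordered_partitions w v \<nu>" "s \<in> {1..w}"
  shows "I s \<subseteq> {1..v}"
  using assms PiE_mem by (auto simp: ordered_partitions_def)

lemma finite_ordered_partition_class:
  assumes "I \<in> ordered_partitions w v \<nu>" "s \<in> {1..w}"
  shows "finite (I s)"
  using ordered_partition_class_subset[OF assms] finite_subset by blast

lemma ordered_partition_classE:
  assumes "I \<in> ordered_partitions w v \<nu>" "i \<in> {1..v}"
  obtains s where "s \<in> {1..w}" "i \<in> I s"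
proof -
  have "(\<Union>s\<in>{1..w}. I s) = {1..v}" using assms(1) by (simp add: ordered_partitions_def)
  then show ?thesis using assms(2) that by blast
qed

text \<open>Induction on the height in a column: the bottom point is confined by its linear factor for
  the variable of its own column, and every further point by the quotient that compares it with
  the point below.\<close>

lemma class_le_column:
  assumes \<sigma>: "\<sigma> permutes {1..w}"
    and e: "e \<in> restr_orders w v \<mu>"
    and I: "I \<in> ordered_partitions w v \<nu>"
    and nz: "W_summand_restr w l \<sigma> I e \<noteq> 0"
    and i: "s \<in> {1..w}" "i \<in> I s"
  shows "s \<le> \<sigma> (fst (e i))"
  using i
proof (induction "snd (e i)" arbitrary: i s)
  have bij: "bij_betw e {1..v} (restr_index w \<mu>)" using e by (simp add: restr_orders_def)
  note fin = finite_ordered_partition_class[OF I]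
  note nz' = nz[unfolded W_summand_restr_def W_perm_summand_def W_id_summand_def]
  have "\<forall>s\<in>{1..w}. \<forall>a\<in>{1..<s}. \<forall>i\<in>I s.
      restr_point l \<sigma> (e i) - zvar (inv \<sigma> a) + of_nat (l a) * hbar \<noteq> 0"
    using nz' fin by simp
  then have lower: "restr_point l \<sigma> (e i) - zvar (inv \<sigma> a) + of_nat (l a) * hbar \<noteq> 0"
    if "s \<in> {1..w}" "a \<in> {1..<s}" "i \<in> I s" for s a i
    using that by blast
  have "\<forall>s\<in>{1..w}. \<forall>t\<in>{1..<s}. \<forall>i\<in>I s. \<forall>k\<in>I t.
      restr_point l \<sigma> (e i) - restr_point l \<sigma> (e k) - 2 * hbar \<noteq> 0"
    using nz' fin by simp
  then have num: "restr_point l \<sigma> (e i) - restr_point l \<sigma> (e k) - 2 * hbar \<noteq> 0"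
    if "s \<in> {1..w}" "t \<in> {1..<s}" "i \<in> I s" "k \<in> I t" for s t i k
    using that by blast
  have idx: "e i \<in> restr_index w \<mu>" if "s \<in> {1..w}" "i \<in> I s" for i s
    using that ordered_partition_class_subset[OF I] bij_betwE[OF bij] by blast
  {
    case 0
    show ?case
    proof (rule ccontr)
      let ?a = "\<sigma> (fst (e i))"
      assume "\<not> s \<le> ?a"
      moreover have "fst (e i) \<in> {1..w}"
        using idx[OF 0(2,3)] by (auto simp: restr_index_def)
      then have "?a \<in> {1..w}" by (simp only: permutes_in_image[OF \<sigma>])
      ultimately have "?a \<in> {1..<s}" by auto
      from lower[OF 0(2) this 0(3)] show False
        using 0(1)[symmetric] permutes_inverses[OF \<sigma>]
        by (simp add: restr_point_lower_factor lin_form_same_0)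
    qed
  next
    case (Suc j)
    have "(fst (e i), j) \<in> restr_index w \<mu>"
      using idx[OF Suc(3,4)] Suc(2) by (auto simp: restr_index_def)
    then obtain k where k: "k \<in> {1..v}" "e k = (fst (e i), j)"
      by (metis bij bij_betw_imp_surj_on imageE)
    obtain t where t: "t \<in> {1..w}" "k \<in> I t"
      using I k(1) by (rule ordered_partition_classE)
    have "s \<le> t"
    proof (rule ccontr)
      assume "\<not> s \<le> t"
      then have "t \<in> {1..<s}" using t by auto
      from num[OF Suc(3) this Suc(4) t(2)] show False
        using Suc(2)[symmetric] k(2) by (simp add: restr_point_numerator lin_form_same_0)
    qed
    also have "t \<le> \<sigma> (fst (e k))" using k t by (intro Suc(1)) auto
    finally show ?case using k by simp
  }
qed

text \<open>The points of the columns up to \<open>a\<close> all lie in the classes up to \<open>a\<close>; the two sides count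
  the former and the latter.\<close>

lemma partial_sums_le:
  assumes \<sigma>: "\<sigma> permutes {1..w}"
    and e: "e \<in> restr_orders w v \<mu>"
    and I: "I \<in> ordered_partitions w v \<nu>"
    and nz: "W_summand_restr w l \<sigma> I e \<noteq> 0"
    and a: "a \<le> w"
  shows "(\<Sum>p\<in>{1..a}. \<mu> (inv \<sigma> p)) \<le> (\<Sum>p\<in>{1..a}. \<nu> p)"
proof -
  have bij: "bij_betw e {1..v} (restr_index w \<mu>)" using e by (simp add: restr_orders_def)
  have invw: "inv \<sigma> p \<in> {1..w}" if "p \<in> {1..a}" for p
    using that a permutes_in_image[OF permutes_inv[OF \<sigma>]] by auto
  \<comment> \<open>the points of the columns up to \<open>a\<close>\<close>
  define C where "C = (SIGMA k:inv \<sigma> ` {1..a}. {..<\<mu> k})"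
  have C_sub: "C \<subseteq> restr_index w \<mu>"
    using invw by (auto simp: C_def restr_index_def)
  have "(\<Sum>p\<in>{1..a}. \<mu> (inv \<sigma> p)) = (\<Sum>k\<in>inv \<sigma> ` {1..a}. \<mu> k)"
    using permutes_inj[OF permutes_inv[OF \<sigma>]] by (simp add: sum.reindex inj_on_def)
  also have "\<dots> = card C"
    by (simp add: C_def)
  also have "\<dots> \<le> card (\<Union>s\<in>{1..a}. I s)"
  proof (rule surj_card_le)
    show "finite (\<Union>s\<in>{1..a}. I s)" using finite_ordered_partition_class[OF I] a by auto
    show "C \<subseteq> e ` (\<Union>s\<in>{1..a}. I s)"
    proof
      fix x assume "x \<in> C"
      then obtain i where i: "i \<in> {1..v}" "x = e i"
        by (metis C_sub bij bij_betw_imp_surj_on imageE subsetD)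
      obtain s where s: "s \<in> {1..w}" "i \<in> I s"
        using I i(1) by (rule ordered_partition_classE)
      have "s \<le> \<sigma> (fst (e i))" by (rule class_le_column[OF \<sigma> e I nz s])
      also have "\<dots> \<le> a"
        using \<open>x \<in> C\<close> i permutes_inverses[OF \<sigma>] by (auto simp: C_def)
      finally have "i \<in> (\<Union>s\<in>{1..a}. I s)" using s by auto
      then show "x \<in> e ` (\<Union>s\<in>{1..a}. I s)" using i(2) by blast
    qed
  qed
  also have "\<dots> \<le> (\<Sum>s\<in>{1..a}. card (I s))" by (rule card_UN_le) simp
  also have "\<dots> = (\<Sum>p\<in>{1..a}. \<nu> p)"
    using I a by (intro sum.cong) (auto simp: ordered_partitions_def)
  finally show ?thesis .
qed

lemma W_restr_eq_0:
  assumes \<sigma>: "\<sigma> permutes {1..w}"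
    and lam: "lam \<in> S_set w v (\<lambda>i. l (\<sigma> i))"
    and \<mu>: "\<mu> \<in> S_set w v (\<lambda>i. l (\<sigma> i))"
    and less: "less_perm \<sigma> lam \<mu>"
    and e: "e \<in> restr_orders w v \<mu>"
  shows "W_restr w v l \<sigma> lam e = 0"
proof -
  let ?\<nu> = "perm_tuple (inv \<sigma>) lam"
  obtain a where a: "?\<nu> a < \<mu> (inv \<sigma> a)" "\<And>b. b < a \<Longrightarrow> ?\<nu> b = \<mu> (inv \<sigma> b)"
    using less by (auto simp: less_perm_def less_fun_def perm_tuple_def)
  \<comment> \<open>The comparison is of functions on all of \<open>nat\<close>, but tuples agree outside \<open>{1..w}\<close>.\<close>
  have "a \<in> {1..w}"
  proof (rule ccontr)
    assume out: "a \<notin> {1..w}"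
    then have "inv \<sigma> a = a" using permutes_inv[OF \<sigma>] by (simp add: permutes_def)
    moreover have "lam a = undefined" "\<mu> a = undefined"
      using lam \<mu> out unfolding S_set_def by (blast intro: PiE_arb)+
    ultimately have "?\<nu> a = \<mu> (inv \<sigma> a)"
      by (simp add: perm_tuple_def)
    then show False using a(1) by simp
  qed
  then have less_sum: "(\<Sum>p\<in>{1..a}. ?\<nu> p) < (\<Sum>p\<in>{1..a}. \<mu> (inv \<sigma> p))"
  proof (intro sum_strict_mono_ex1 ballI)
    show "?\<nu> p \<le> \<mu> (inv \<sigma> p)" if "p \<in> {1..a}" for p
      using that a by (cases "p = a") auto
  qed (use a in auto)
  have "W_summand_restr w l \<sigma> I e = 0" if "I \<in> ordered_partitions w v ?\<nu>" for I
  proof (rule ccontr)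
    assume "W_summand_restr w l \<sigma> I e \<noteq> 0"
    from partial_sums_le[OF \<sigma> e that this, of a] less_sum \<open>a \<in> {1..w}\<close> show False by simp
  qed
  then show ?thesis
    by (simp add: W_restr_def W_perm_def W_id_def W_summand_restr_def W_perm_summand_def)
qed


section \<open>Degrees\<close>

lemma ordered_partition_card_sum:
  assumes "I \<in> ordered_partitions w v \<nu>"
  shows "(\<Sum>s\<in>{1..w}. card (I s)) = v"
proof -
  have "card (\<Union>s\<in>{1..w}. I s) = (\<Sum>s\<in>{1..w}. card (I s))"
    using assms finite_ordered_partition_class[OF assms]
    by (intro card_UN_disjoint) (auto simp: ordered_partitions_def disjoint_family_on_def)
  then show ?thesis using assms by (simp add: ordered_partitions_def)
qed

text \<open>A point in class \<open>s\<close> has one linear factor for each \<open>a \<noteq> s\<close>. For \<open>w = 0\<close> the factor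
  \<open>int w - 1\<close> is negative, but then \<open>v = 0\<close>.\<close>

lemma count_linear_factors:
  assumes "I \<in> ordered_partitions w v \<nu>"
  shows "(\<Sum>s\<in>{1..w}. \<Sum>a\<in>{s<..w}. \<Sum>i\<in>I s. 1) + (\<Sum>s\<in>{1..w}. \<Sum>a\<in>{1..<s}. \<Sum>i\<in>I s. 1) =
    int v * (int w - 1)"
proof -
  have "(\<Sum>s\<in>{1..w}. \<Sum>a\<in>{s<..w}. \<Sum>i\<in>I s. 1) + (\<Sum>s\<in>{1..w}. \<Sum>a\<in>{1..<s}. \<Sum>i\<in>I s. 1) =
    (\<Sum>s\<in>{1..w}. int (card (I s)) * (int w - 1))"
    unfolding sum.distrib[symmetric] by (intro sum.cong) (auto simp: of_nat_diff algebra_simps)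
  also have "\<dots> = int (\<Sum>s\<in>{1..w}. card (I s)) * (int w - 1)"
    by (simp add: sum_distrib_right)
  finally show ?thesis by (simp only: ordered_partition_card_sum[OF assms])
qed

text \<open>Quotients contribute at most \<open>0\<close> and linear factors, which compare a point with a
  variable, at most \<open>1\<close> each; and their number does not depend on the partition.\<close>

lemma degree_summand_le:
  assumes I: "I \<in> ordered_partitions w v \<nu>"
  shows "rat_degree (W_summand_restr w l \<sigma> I e) \<le> Fin (int v * (int w - 1))"
proof -
  have "rat_degree (W_summand_restr w l \<sigma> I e) \<le>
    Fin ((\<Sum>s\<in>{1..w}. \<Sum>t\<in>{1..<s}. \<Sum>i\<in>I s. \<Sum>k\<in>I t. 0) +
         (\<Sum>s\<in>{1..w}. \<Sum>a\<in>{s<..w}. \<Sum>i\<in>I s. 1) + (\<Sum>s\<in>{1..w}. \<Sum>a\<in>{1..<s}. \<Sum>i\<in>I s. 1))"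
    unfolding W_summand_restr_def W_perm_summand_def W_id_summand_def
    by (intro rat_degree_mult_le rat_degree_prod_le rat_degree_y_quotient_le)
       (simp_all only: restr_point_upper_factor restr_point_lower_factor rat_degree_lin_form_le)
  also have "\<dots> = Fin (int v * (int w - 1))"
    using count_linear_factors[OF I] by simp
  finally show ?thesis .
qed

definition column_partition ::
  "nat \<Rightarrow> nat \<Rightarrow> (nat \<Rightarrow> nat) \<Rightarrow> (nat \<Rightarrow> nat \<times> nat) \<Rightarrow> nat \<Rightarrow> nat set" where
  "column_partition w v \<sigma> e = (\<lambda>s\<in>{1..w}. {i\<in>{1..v}. \<sigma> (fst (e i)) = s})"

lemma column_partition_in:
  assumes \<sigma>: "\<sigma> permutes {1..w}" and e: "e \<in> restr_orders w v lam"
  shows "column_partition w v \<sigma> e \<in> ordered_partitions w v (perm_tuple (inv \<sigma>) lam)"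
proof -
  have bij: "bij_betw e {1..v} (restr_index w lam)" using e by (simp add: restr_orders_def)
  have column: "\<sigma> (fst (e i)) \<in> {1..w}" if "i \<in> {1..v}" for i
  proof -
    have "e i \<in> restr_index w lam" using bij_betwE[OF bij] that by blast
    then have "fst (e i) \<in> {1..w}" by (auto simp: restr_index_def)
    then show ?thesis by (simp only: permutes_in_image[OF \<sigma>])
  qed
  have card: "card {i\<in>{1..v}. \<sigma> (fst (e i)) = s} = lam (inv \<sigma> s)" if "s \<in> {1..w}" for s
  proof -
    have inv_s: "inv \<sigma> s \<in> {1..w}"
      using that by (simp only: permutes_in_image[OF permutes_inv[OF \<sigma>]])
    have \<sigma>_eq: "\<sigma> k = s \<longleftrightarrow> k = inv \<sigma> s" for k
      unfolding permutes_inv_eq[OF \<sigma>, symmetric] by (rule eq_commute)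
    have "inj_on e {i\<in>{1..v}. \<sigma> (fst (e i)) = s}"
      by (rule inj_on_subset[OF bij_betw_imp_inj_on[OF bij]]) blast
    then have "card {i\<in>{1..v}. \<sigma> (fst (e i)) = s} = card (e ` {i\<in>{1..v}. \<sigma> (fst (e i)) = s})"
      by (rule card_image[symmetric])
    also have "e ` {i\<in>{1..v}. \<sigma> (fst (e i)) = s} = {x \<in> restr_index w lam. \<sigma> (fst x) = s}"
      unfolding bij_betw_imp_surj_on[OF bij, symmetric] by blast
    also have "\<dots> = {inv \<sigma> s} \<times> {..<lam (inv \<sigma> s)}"
      unfolding \<sigma>_eq using inv_s by (auto simp: restr_index_def)
    finally show ?thesis by (simp add: card_cartesian_product)
  qed
  let ?I = "column_partition w v \<sigma> e"
  have class_eq: "?I s = {i\<in>{1..v}. \<sigma> (fst (e i)) = s}" if "s \<in> {1..w}" for s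
    using that by (simp add: column_partition_def)
  have "?I \<in> {1..w} \<rightarrow>\<^sub>E Pow {1..v}"
    by (auto simp: column_partition_def)
  moreover have "disjoint_family_on ?I {1..w}"
    unfolding disjoint_family_on_def
  proof (intro ballI impI)
    fix s t assume s: "s \<in> {1..w}" and t: "t \<in> {1..w}" and "s \<noteq> t"
    then show "?I s \<inter> ?I t = {}" unfolding class_eq[OF s] class_eq[OF t] by blast
  qed
  moreover have "(\<Union>s\<in>{1..w}. ?I s) = {1..v}"
  proof -
    have "(\<Union>s\<in>{1..w}. ?I s) = (\<Union>s\<in>{1..w}. {i\<in>{1..v}. \<sigma> (fst (e i)) = s})"
      by (intro SUP_cong refl class_eq)
    also have "\<dots> = {1..v}" using column by blast
    finally show ?thesis .
  qed
  moreover have "\<forall>s\<in>{1..w}. card (?I s) = perm_tuple (inv \<sigma>) lam s"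
    using class_eq card by (simp add: perm_tuple_def)
  ultimately show ?thesis
    unfolding ordered_partitions_def by blast
qed

text \<open>Different classes are different columns, and \<open>z\<close>-variables cancel only within a column; so
  every quotient has degree exactly \<open>0\<close> and every linear factor exactly \<open>1\<close>.\<close>

lemma degree_column_partition:
  assumes \<sigma>: "\<sigma> permutes {1..w}" and e: "e \<in> restr_orders w v lam"
  shows "rat_degree (W_summand_restr w l \<sigma> (column_partition w v \<sigma> e) e) =
    Fin (int v * (int w - 1))"
proof -
  let ?I = "column_partition w v \<sigma> e"
  have col: "\<sigma> (fst (e i)) = s" if "i \<in> ?I s" "s \<in> {1..w}" for i s
    using that by (simp add: column_partition_def)
  have quot: "rat_degree (y_quotient l \<sigma> (e i) (e k)) = Fin 0"
    if "s \<in> {1..w}" "t \<in> {1..<s}" "i \<in> ?I s" "k \<in> ?I t" for s t i k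
  proof (rule rat_degree_y_quotient_ne)
    have "t \<in> {1..w}" "t \<noteq> s" using that(1,2) by auto
    then have "\<sigma> (fst (e i)) \<noteq> \<sigma> (fst (e k))"
      by (simp only: col[OF that(3,1)] col[OF that(4)] not_sym)
    then show "fst (e i) \<noteq> fst (e k)" by metis
  qed
  have ne: "inv \<sigma> a \<noteq> fst (e i)" if "s \<in> {1..w}" "a \<noteq> s" "i \<in> ?I s" for s a i
  proof
    assume "inv \<sigma> a = fst (e i)"
    then have "\<sigma> (inv \<sigma> a) = s" by (simp only: col[OF that(3,1)])
    then show False using that(2) by (simp only: permutes_inverses(1)[OF \<sigma>])
  qed
  have upper: "inv \<sigma> a \<noteq> fst (e i)" if "s \<in> {1..w}" "a \<in> {s<..w}" "i \<in> ?I s" for s a i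
    using that(2) by (intro ne[OF that(1) _ that(3)]) simp
  have lower: "fst (e i) \<noteq> inv \<sigma> a" if "s \<in> {1..w}" "a \<in> {1..<s}" "i \<in> ?I s" for s a i
    using that(2) by (intro ne[OF that(1) _ that(3), symmetric]) simp
  have "rat_degree (W_summand_restr w l \<sigma> ?I e) =
    Fin ((\<Sum>s\<in>{1..w}. \<Sum>t\<in>{1..<s}. \<Sum>i\<in>?I s. \<Sum>k\<in>?I t. 0) +
         (\<Sum>s\<in>{1..w}. \<Sum>a\<in>{s<..w}. \<Sum>i\<in>?I s. 1) + (\<Sum>s\<in>{1..w}. \<Sum>a\<in>{1..<s}. \<Sum>i\<in>?I s. 1))"
    unfolding W_summand_restr_def W_perm_summand_def W_id_summand_def
    unfolding restr_point_upper_factor restr_point_lower_factor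
    by (intro rat_degree_mult_eq rat_degree_prod_eq rat_degree_lin_form_ne)
       (rule quot upper lower; assumption)+
  also have "\<dots> = Fin (int v * (int w - 1))"
    using count_linear_factors[OF column_partition_in[OF \<sigma> e]] by simp
  finally show ?thesis .
qed

lemma finite_ordered_partitions: "finite (ordered_partitions w v \<nu>)"
  unfolding ordered_partitions_def
  by (rule finite_subset[of _ "{1..w} \<rightarrow>\<^sub>E Pow {1..v}"]) (blast, rule finite_PiE, simp_all)

theorem lemma5p2:
  fixes w v :: nat and l :: "nat \<Rightarrow> nat" and \<sigma> lam \<mu> :: "nat \<Rightarrow> nat"
  assumes "\<And>i. i \<in> {1..w} \<Longrightarrow> l i > 0"
    and "\<sigma> permutes {1..w}"
    and "lam \<in> S_set w v (\<lambda>i. l (\<sigma> i))"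
    and "\<mu> \<in> S_set w v (\<lambda>i. l (\<sigma> i))"
  shows "(less_perm \<sigma> lam \<mu> \<longrightarrow> (\<forall>f \<in> restr_orders w v \<mu>. W_restr w v l \<sigma> lam f = 0)) \<and>
         (le_perm \<sigma> \<mu> lam \<longrightarrow>
            (\<forall>e \<in> restr_orders w v lam. \<forall>f \<in> restr_orders w v \<mu>.
               W_restr_degree w v l \<sigma> lam e \<ge> W_restr_degree w v l \<sigma> lam f))"
proof (intro conjI impI ballI)
  fix f assume "less_perm \<sigma> lam \<mu>" "f \<in> restr_orders w v \<mu>"
  with assms(2-4) show "W_restr w v l \<sigma> lam f = 0" by (rule W_restr_eq_0)
next
  fix e f assume e: "e \<in> restr_orders w v lam"
  let ?\<P> = "ordered_partitions w v (perm_tuple (inv \<sigma>) lam)"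
  have mem: "column_partition w v \<sigma> e \<in> ?\<P>"
    by (rule column_partition_in[OF assms(2) e])
  have "W_restr_degree w v l \<sigma> lam f \<le> Fin (int v * (int w - 1))"
    unfolding W_restr_degree_def
  proof (rule Max.boundedI)
    show "finite ((\<lambda>I. rat_degree (W_summand_restr w l \<sigma> I f)) ` ?\<P>)"
      by (intro finite_imageI finite_ordered_partitions)
    show "(\<lambda>I. rat_degree (W_summand_restr w l \<sigma> I f)) ` ?\<P> \<noteq> {}"
      using mem by blast
  next
    fix d assume "d \<in> (\<lambda>I. rat_degree (W_summand_restr w l \<sigma> I f)) ` ?\<P>"
    then show "d \<le> Fin (int v * (int w - 1))"
      by (elim imageE) (simp only: degree_summand_le)
  qed
  also have "\<dots> = rat_degree (W_summand_restr w l \<sigma> (column_partition w v \<sigma> e) e)"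
    by (rule degree_column_partition[OF assms(2) e, symmetric])
  also have "\<dots> \<le> W_restr_degree w v l \<sigma> lam e"
    unfolding W_restr_degree_def
    by (intro Max_ge finite_imageI finite_ordered_partitions imageI mem)
  finally show "W_restr_degree w v l \<sigma> lam f \<le> W_restr_degree w v l \<sigma> lam e" .
qed

end
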